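(* Let $\mathbf M=(M_K)_{K\in\mathcal M_n^\times}$ be a $w_0$-BZ datum. For each $i\in I$ and $K\in\mathcal M_n^\times$, $$(\tilde f_i\mathbf M)_K=\begin{cases}\min\{M_K,\ M_{s_iK}+c_i(\mathbf M)\} & \text{if } i\in K \text{ and } i+1\notin K,\\ M_K & \text{otherwise,}\end{cases}$$ where $c_i(\mathbf M)=M_{[1,i]}-M_{[1,i+1]\setminus\{i\}}-1$.
   Context: Let $n\ge1$, $I=\{1,\dots,n\}$. $\mathcal M_n$ is the set of all subsets of $[1,n+1]$ and $\mathcal M_n^\times=\mathcal M_n\setminus\{\emptyset,[1,n+1]\}$. The simple reflection $s_i\in\mathfrak S_{n+1}$ transposes $i$ and $i+1$, and $s_iK$ is the image of $K$. A $w_0$-BZ datum (of type $A_n$) is a family of integers $\mathbf M=(M_K)_{K\in\mathcal M_n^\times}$ such that, with the convention $M_\emptyset=M_{[1,n+1]}=0$ and writing $Kij=K\cup\{i,j\}$ etc.: (i) $M_{[n-i+2,n+1]}=0$ for all $i\in I$; (ii) $M_{Ki}+M_{Kj}\le M_{Kij}+M_K$ for all $i\ne j$ in $[1,n+1]$ and $K\in\mathcal M_n$ with $K\cap\{i,j\}=\emptyset$; (iii) $M_{Kik}+M_{Kj}=\min\{M_{Kij}+M_{Kk},\,M_{Kjk}+M_{Ki}\}$ for all $i<j<k$ in $[1,n+1]$ and $K\in\mathcal M_n$ with $K\cap\{i,j,k\}=\emptyset$. Lowering Kashiwara operator: by a result of Kamnitzer, for each $w_0$-BZ datum $\mathbf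 M$ and $i\in I$ there is a unique $w_0$-BZ datum, denoted $\tilde f_i\mathbf M$, such that $(\tilde f_i\mathbf M)_{[1,i]}=M_{[1,i]}-1$ and $(\tilde f_i\mathbf M)_K=M_K$ for every $K\in\mathcal M_n^\times$ that does not satisfy ($i\in K$ and $i+1\notin K$). *)

theory Defs
  imports Main "HOL-Combinatorics.Transposition"
begin

definition Mn :: "nat \<Rightarrow> nat set set" where
  "Mn n = Pow {1..n+1}"

definition Mn_proper :: "nat \<Rightarrow> nat set set" where
  "Mn_proper n = Mn n - {{}, {1..n+1}}"

text \<open>
  A family of integers indexed by \<^term>\<open>Mn_proper n\<close> is represented by a function on all sets
  that vanishes off \<^term>\<open>Mn_proper n\<close>.  This makes the representation unique, and it
  includes the convention that the entries at the empty set and at the full set are zero.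
\<close>

definition BZ_datum :: "nat \<Rightarrow> (nat set \<Rightarrow> int) \<Rightarrow> bool" where
  "BZ_datum n M \<longleftrightarrow>
     (\<forall>K. K \<notin> Mn_proper n \<longrightarrow> M K = 0) \<and>
     (\<forall>i\<in>{1..n}. M {n + 2 - i..n+1} = 0) \<and>
     (\<forall>i\<in>{1..n+1}. \<forall>j\<in>{1..n+1}. \<forall>K\<in>Mn n. i \<noteq> j \<and> K \<inter> {i, j} = {} \<longrightarrow>
        M (K \<union> {i}) + M (K \<union> {j}) \<le> M (K \<union> {i, j}) + M K) \<and>
     (\<forall>i\<in>{1..n+1}. \<forall>j\<in>{1..n+1}. \<forall>k\<in>{1..n+1}. \<forall>K\<in>Mn n.
        i < j \<and> j < k \<and> K \<inter> {i, j, k} = {} \<longrightarrow>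
        M (K \<union> {i, k}) + M (K \<union> {j}) =
          min (M (K \<union> {i, j}) + M (K \<union> {k})) (M (K \<union> {j, k}) + M (K \<union> {i})))"

definition lowering :: "nat \<Rightarrow> nat \<Rightarrow> (nat set \<Rightarrow> int) \<Rightarrow> nat set \<Rightarrow> int" where
  "lowering n i M = (THE N. BZ_datum n N \<and> N {1..i} = M {1..i} - 1 \<and>
     (\<forall>K\<in>Mn_proper n. \<not> (i \<in> K \<and> i + 1 \<notin> K) \<longrightarrow> N K = M K))"

definition BZ_c :: "nat \<Rightarrow> (nat set \<Rightarrow> int) \<Rightarrow> int" where
  "BZ_c i M = M {1..i} - M ({1..i+1} - {i}) - 1"

end

theory Submission
  imports Defs
begin

text \<open>
  Write \<open>x\<^sub>L\<close>, \<open>y\<^sub>L\<close>, \<open>z\<^sub>L\<close>, \<open>w\<^sub>L\<close> for the entries at \<open>L\<close> with \<open>i\<close>, \<open>i + 1\<close>, none and both of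
  them added. The candidate replaces \<open>x\<^sub>L\<close> by \<open>min x\<^sub>L (y\<^sub>L + d)\<close>, the tropical form of adding a
  multiple of column \<open>i + 1\<close> to column \<open>i\<close> in the flag minors of a matrix. The three-term relations
  survive for the same reason as classically; the only ones that are not linear in \<open>x\<close> need the
  tropical version of the mixed identity
  \<open>x\<^bsub>ac\<^esub> y\<^sub>b + y\<^bsub>ac\<^esub> x\<^sub>b = x\<^bsub>ab\<^esub> y\<^sub>c + y\<^bsub>ab\<^esub> x\<^sub>c + x\<^bsub>bc\<^esub> y\<^sub>a + y\<^bsub>bc\<^esub> x\<^sub>a\<close>,
  which follows from three-term relations among subsets of the five indices involved. The datum is
  unique because the relation on \<open>i, i + 1, k\<close> determines \<open>x\<^bsub>Lk\<^esub>\<close> from \<open>x\<^sub>L\<close> for \<open>k > i + 1\<close>, and \<open>x\<^sub>L\<close>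
  from \<open>x\<^bsub>Lk\<^esub>\<close> for \<open>k < i\<close>, starting at \<open>L = {1..i-1}\<close>.
\<close>

section \<open>Supermodularity, three-term relations and their stability under
  \<open>lower\<close>\<close>

text \<open>All normalisations to zero are left out, so stability can be shown for an arbitrary
  shift \<open>d\<close>.\<close>

locale tropical_flag =
  fixes E :: "nat set" and M :: "nat set \<Rightarrow> int"
  assumes supermodular: "\<lbrakk>a \<in> E; b \<in> E; a \<noteq> b; K \<subseteq> E; a \<notin> K; b \<notin> K\<rbrakk> \<Longrightarrow>
      M (insert a K) + M (insert b K) \<le> M (insert a (insert b K)) + M K"
    and pluecker: "\<lbrakk>a \<in> E; b \<in> E; c \<in> E; a < b; b < c; K \<subseteq> E; a \<notin> K; b \<notin> K; c \<notin> K\<rbrakk> \<Longrightarrow>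
      M (insert a (insert c K)) + M (insert b K) =
        min (M (insert a (insert b K)) + M (insert c K)) (M (insert b (insert c K)) + M (insert a K))"

text \<open>In the first branch \<open>insert q (K - {p})\<close> is the image of \<open>K\<close>
  under the transposition of \<open>p\<close> and \<open>q\<close>. Keeping \<open>q\<close>
  separate from \<open>p + 1\<close> makes the role of adjacency explicit.\<close>

definition lower :: "nat \<Rightarrow> nat \<Rightarrow> int \<Rightarrow> (nat set \<Rightarrow> int) \<Rightarrow> nat set \<Rightarrow> int" where
  "lower p q d M K =
     (if p \<in> K \<and> q \<notin> K then min (M K) (M (insert q (K - {p})) + d) else M K)"

context tropical_flag
begin

text \<open>This is the nonlinear case of stability, with \<open>K = insert p L\<close>. The closing
  disjunction lists the places that a pair \<open>p < q\<close> can take among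
  \<open>a < b < c\<close> when none of these lies between \<open>p\<close> and
  \<open>q\<close>.\<close>

lemma pluecker_lower_neither:
  assumes "p \<in> E" "q \<in> E" "a \<in> E" "b \<in> E" "c \<in> E" "L \<subseteq> E"
    and "p \<notin> L" "q \<notin> L" "a \<notin> L" "b \<notin> L" "c \<notin> L"
    and "p < q" "a < b" "b < c"
    and "c < p \<or> b < p \<and> q < c \<or> a < p \<and> q < b \<or> q < a"
  shows "min (M (insert p (insert a (insert c L)))) (M (insert q (insert a (insert c L))) + d) +
         min (M (insert p (insert b L))) (M (insert q (insert b L)) + d) =
    min (min (M (insert p (insert a (insert b L)))) (M (insert q (insert a (insert b L))) + d) +
         min (M (insert p (insert c L))) (M (insert q (insert c L)) + d))
        (min (M (insert p (insert b (insert c L)))) (M (insert q (insert b (insert c L))) + d) +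
         min (M (insert p (insert a L))) (M (insert q (insert a L)) + d))"
proof -
  have "min (M (insert p (insert a (insert c L))) + M (insert q (insert b L)))
            (M (insert q (insert a (insert c L))) + M (insert p (insert b L))) =
    min (min (M (insert p (insert a (insert b L))) + M (insert q (insert c L)))
             (M (insert q (insert a (insert b L))) + M (insert p (insert c L))))
        (min (M (insert p (insert b (insert c L))) + M (insert q (insert a L)))
             (M (insert q (insert b (insert c L))) + M (insert p (insert a L))))"
    using assms(15)
  proof (elim disjE conjE)
    assume "c < p"
    then show ?thesis
      using assms(1-14) pluecker[of a b c "insert p L"] pluecker[of a b c "insert q L"]
        pluecker[of b c p "insert a L"] pluecker[of b c q "insert a L"]
        pluecker[of a c p "insert b L"] pluecker[of a p q "insert b L"] pluecker[of c p q "insert b L"]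
      by (simp add: insert_commute) (smt (verit))
  next
    assume "b < p" "q < c"
    then show ?thesis
      using assms(1-14) pluecker[of a b q "insert p L"] pluecker[of a q c "insert p L"]
        pluecker[of b q c "insert p L"] pluecker[of a b p "insert q L"]
        pluecker[of a p c "insert q L"] pluecker[of b p c "insert q L"]
      by (simp add: insert_commute) (smt (verit))
  next
    assume "a < p" "q < b"
    then show ?thesis
      using assms(1-14) pluecker[of a q b "insert p L"] pluecker[of a q c "insert p L"]
        pluecker[of q b c "insert p L"] pluecker[of a p b "insert q L"]
        pluecker[of a p c "insert q L"] pluecker[of p b c "insert q L"]
      by (simp add: insert_commute) (smt (verit))
  next
    assume "q < a"
    then show ?thesis
      using assms(1-14) pluecker[of a b c "insert p L"] pluecker[of a b c "insert q L"]
        pluecker[of p q b "insert a L"] pluecker[of p q c "insert a L"] pluecker[of q b c "insert a L"]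
        pluecker[of p a b "insert c L"] pluecker[of q a b "insert c L"]
      by (simp add: insert_commute) (smt (verit))
  qed
  moreover have "a \<noteq> p" "b \<noteq> p" "c \<noteq> p" "a \<noteq> q" "b \<noteq> q" "c \<noteq> q"
    using assms(12-15) by auto
  \<comment> \<open>Each sum of minima expands as a tropical polynomial in \<open>d\<close>. The
    terms free of \<open>d\<close> and those with \<open>2 * d\<close> match by
    \<open>pluecker\<close> over \<open>insert p L\<close> and \<open>insert q L\<close>, the terms
    with a single \<open>d\<close> by the mixed identity above.\<close>
  moreover have "min x (y + d) + min x' (y' + d) =
      min (min (x + x') (y + y' + 2 * d)) (min (x + y') (y + x') + d)" for x y x' y' :: int
    by linarith
  ultimately show ?thesis
    using assms(1-14) pluecker[of a b c "insert p L"] pluecker[of a b c "insert q L"]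
    by (simp add: insert_commute) (smt (verit))
qed

text \<open>After the same expansion, supermodularity over \<open>insert p L\<close> and
  \<open>insert q L\<close> handles the extreme terms. The terms with a single \<open>d\<close> need
  \<open>min (x\<^sub>a + y\<^sub>b) (y\<^sub>a + x\<^sub>b) \<le> min (x\<^sub>a\<^sub>b + y)
  (y\<^sub>a\<^sub>b + x)\<close>, where three-term relations are combined with
  supermodularity.\<close>

lemma supermodular_lower_neither:
  assumes "p \<in> E" "q \<in> E" "a \<in> E" "b \<in> E" "L \<subseteq> E"
    and "p \<notin> L" "q \<notin> L" "a \<notin> L" "b \<notin> L"
    and "p < q" "a < b"
    and "b < p \<or> a < p \<and> q < b \<or> q < a"
  shows "min (M (insert p (insert a L))) (M (insert q (insert a L)) + d) +
         min (M (insert p (insert b L))) (M (insert q (insert b L)) + d) \<le>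
         min (M (insert p (insert a (insert b L)))) (M (insert q (insert a (insert b L))) + d) +
         min (M (insert p L)) (M (insert q L) + d)"
  using assms(12)
proof (elim disjE conjE)
  assume "b < p"
  then show ?thesis
    using assms(1-11) pluecker[of a b p L] pluecker[of a b q L] pluecker[of a p q L]
      pluecker[of b p q L] pluecker[of a b q "insert p L"] pluecker[of a b p "insert q L"]
      pluecker[of b p q "insert a L"] pluecker[of a p q "insert b L"]
      supermodular[of a b "insert p L"] supermodular[of a b "insert q L"]
      supermodular[of p a "insert q L"] supermodular[of p b "insert q L"]
      supermodular[of a q "insert b L"] supermodular[of b q "insert a L"]
    by (simp add: insert_commute) (smt (verit))
next
  assume "a < p" "q < b"
  then show ?thesis
    using assms(1-11) pluecker[of a p b L] pluecker[of a q b L] pluecker[of a p q L]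
      pluecker[of p q b L] pluecker[of a q b "insert p L"] pluecker[of a p b "insert q L"]
      pluecker[of p q b "insert a L"] pluecker[of a p q "insert b L"]
      supermodular[of a b "insert p L"] supermodular[of a b "insert q L"]
      supermodular[of p a "insert q L"] supermodular[of p b "insert q L"]
      supermodular[of a q "insert b L"] supermodular[of b q "insert a L"]
    by (simp add: insert_commute) (smt (verit))
next
  assume "q < a"
  then show ?thesis
    using assms(1-11) pluecker[of p a b L] pluecker[of q a b L] pluecker[of p q a L]
      pluecker[of p q b L] pluecker[of q a b "insert p L"] pluecker[of p a b "insert q L"]
      pluecker[of p q b "insert a L"] pluecker[of p q a "insert b L"]
      supermodular[of a b "insert p L"] supermodular[of a b "insert q L"]
      supermodular[of p a "insert q L"] supermodular[of p b "insert q L"]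
      supermodular[of a q "insert b L"] supermodular[of b q "insert a L"]
    by (simp add: insert_commute) (smt (verit))
qed

lemma tropical_flag_lower:
  assumes "p \<in> E" "q \<in> E" "p < q" and adj: "\<And>e. e \<in> E \<Longrightarrow> e < p \<or> e = p \<or> e = q \<or> q < e"
  shows "tropical_flag E (lower p q d M)"
proof
  fix a b K
  assume ab: "a \<in> E" "b \<in> E" "a \<noteq> b" and K: "K \<subseteq> E" "a \<notin> K" "b \<notin> K"
  show "lower p q d M (insert a K) + lower p q d M (insert b K) \<le>
        lower p q d M (insert a (insert b K)) + lower p q d M K"
    using ab K
  proof (induction a b rule: linorder_wlog)
    case (le a b)
    then have "a < b"
      by simp
    define L where "L = K - {p}"
    have K_eq: "p \<in> K \<Longrightarrow> K = insert p L" "p \<notin> K \<Longrightarrow> K = L" and L: "p \<notin> L" "a \<notin> L" "b \<notin> L" "L \<subseteq> E"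
      using le by (auto simp: L_def)
    show ?case
    proof (cases "{a, b} \<inter> {p, q} = {}")
      case True
      show ?thesis
      proof (cases "p \<in> K \<and> q \<notin> K")
        case True
        then show ?thesis
          using supermodular_lower_neither[of p q a b L d] \<open>{a, b} \<inter> {p, q} = {}\<close> \<open>a < b\<close>
            adj[of a] adj[of b] assms L le K_eq(1)
          by (auto simp: lower_def insert_Diff_if insert_commute)
      next
        case False
        then show ?thesis
          using True le supermodular[of a b K] by (auto simp: lower_def)
      qed
    next
      case False
      then consider "a = p" "b = q" | "a = p" "b \<noteq> q" | "b = p" "a \<noteq> q" | "a = q" "b \<noteq> p" | "b = q" "a \<noteq> p"
        using \<open>a < b\<close> \<open>p < q\<close> by fastforce
      then show ?thesis
      proof cases
        case 1
        then show ?thesis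
          using le supermodular[of a b K] by (auto simp: lower_def)
      next
        \<comment> \<open>From here on, if \<open>lower\<close> changes anything, it changes one
          term on each side. The claim is then the minimum of the inequality for \<open>M\<close>
          and, shifted by \<open>d\<close>, the one with \<open>p\<close> and \<open>q\<close>
          exchanged.\<close>
        case 2
        then show ?thesis
          using le assms supermodular[of a b K] supermodular[of q b K]
          by (auto simp: lower_def insert_Diff_if insert_commute)
      next
        case 3
        then show ?thesis
          using le assms supermodular[of a b K] supermodular[of a q K]
          by (auto simp: lower_def insert_Diff_if insert_commute)
      next
        case 4
        then show ?thesis
          using le assms supermodular[of a b K] supermodular[of p b "insert q L"] K_eq L
          by (auto simp: lower_def insert_Diff_if insert_commute)
      next
        case 5
        then show ?thesis
          using le assms supermodular[of a b K] supermodular[of a p "insert q L"] K_eq L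
          by (auto simp: lower_def insert_Diff_if insert_commute)
      qed
    qed
  next
    case (sym a b)
    then show ?case
      by (simp add: insert_commute add.commute)
  qed
next
  fix a b c K
  assume abc: "a \<in> E" "b \<in> E" "c \<in> E" "a < b" "b < c" and K: "K \<subseteq> E" "a \<notin> K" "b \<notin> K" "c \<notin> K"
  show "lower p q d M (insert a (insert c K)) + lower p q d M (insert b K) =
        min (lower p q d M (insert a (insert b K)) + lower p q d M (insert c K))
            (lower p q d M (insert b (insert c K)) + lower p q d M (insert a K))"
  proof -
    define L where "L = K - {p}"
    have K_eq: "p \<in> K \<Longrightarrow> K = insert p L" "p \<notin> K \<Longrightarrow> K = L"
      and L: "p \<notin> L" "a \<notin> L" "b \<notin> L" "c \<notin> L" "L \<subseteq> E"
      using K by (auto simp: L_def)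
    note simps = lower_def insert_Diff_if insert_commute
    have ord: "a < p \<or> a = p \<or> a = q \<or> q < a" "b < p \<or> b = p \<or> b = q \<or> q < b"
      "c < p \<or> c = p \<or> c = q \<or> q < c"
      using abc adj by auto
    show ?thesis
    \<comment> \<open>In the negative case all sets involved contain \<open>q\<close> or none
      contains \<open>p\<close>, so \<open>lower\<close> changes no entry.\<close>
    proof (cases "p \<in> insert a (insert b (insert c K)) \<and> q \<notin> K")
      case False
      then consider "q \<in> K" | "p \<noteq> a" "p \<noteq> b" "p \<noteq> c" "p \<notin> K"
        by blast
      then show ?thesis
        using abc K pluecker[of a b c K] by cases (simp_all add: lower_def)
    next
      case True
      consider "a \<noteq> p" "a \<noteq> q" "b \<noteq> p" "b \<noteq> q" "c \<noteq> p" "c \<noteq> q"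
        | "a = p" "b = q" | "b = p" "c = q" | "a = p" "q < b" | "b = p" "q < c" | "c = p"
        | "a = q" | "b = q" "a < p" | "c = q" "b < p"
        using ord abc(4,5) \<open>p < q\<close> by (metis less_asym)
      then show ?thesis
      proof cases
        case 1
        moreover have "c < p \<or> b < p \<and> q < c \<or> a < p \<and> q < b \<or> q < a"
          using 1 ord abc(4,5) by auto
        moreover have "p \<in> K"
          using 1 True by simp
        ultimately show ?thesis
          using True pluecker_lower_neither[of p q a b c L d] abc K_eq(1) L assms(1-3)
          by (simp add: simps)
      next
        \<comment> \<open>When \<open>p\<close> and \<open>q\<close> are both among the three
          indices, \<open>lower\<close> adds the same term to the minimum on each side, here
          \<open>M (insert q (insert c K)) + M (insert q K) + d\<close>.\<close>
        case 2
        then show ?thesis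
          using True abc K pluecker[of a b c K] by (simp add: simps; smt (verit))
      next
        case 3
        then show ?thesis
          using True abc K pluecker[of a b c K] by (simp add: simps; smt (verit))
      next
        \<comment> \<open>In this and the later cases each of the three sums has exactly one changed
          term, so the relation is the minimum of the one for \<open>M\<close> and, shifted by
          \<open>d\<close>, the one with \<open>p\<close> and \<open>q\<close> exchanged.\<close>
        case 4
        then show ?thesis
          using True abc K assms(1-3) pluecker[of a b c K] pluecker[of q b c K]
          by (simp add: simps; smt (verit))
      next
        case 5
        then show ?thesis
          using True abc K assms(1-3) pluecker[of a b c K] pluecker[of a q c K]
          by (simp add: simps; smt (verit))
      next
        case 6
        then show ?thesis
          using True abc K assms(1-3) pluecker[of a b c K] pluecker[of a b q K]
          by (simp add: simps; smt (verit))
      next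
        case 7
        then show ?thesis
          using True abc K assms(1-3) K_eq(1) L pluecker[of a b c K] pluecker[of p b c "insert q L"]
          by (simp add: simps; smt (verit))
      next
        case 8
        then show ?thesis
          using True abc K assms(1-3) K_eq(1) L pluecker[of a b c K] pluecker[of a p c "insert q L"]
          by (simp add: simps; smt (verit))
      next
        case 9
        then show ?thesis
          using True abc K assms(1-3) K_eq(1) L pluecker[of a b c K] pluecker[of a b p "insert q L"]
          by (simp add: simps; smt (verit))
      qed
    qed
  qed
qed

end

section \<open>Uniqueness from the entry at an initial segment\<close>

lemma tropical_flag_unique:
  assumes "tropical_flag E M" "tropical_flag E N" "finite E"
    and pq: "p \<in> E" "q \<in> E" "p < q" "\<And>e. e \<in> E \<Longrightarrow> e < p \<or> e = p \<or> e = q \<or> q < e"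
    and same: "\<And>K. K \<subseteq> E \<Longrightarrow> \<not> (p \<in> K \<and> q \<notin> K) \<Longrightarrow> N K = M K"
    and start: "N {e \<in> E. e \<le> p} = M {e \<in> E. e \<le> p}"
    and "K \<subseteq> E"
  shows "N K = M K"
proof -
  interpret M: tropical_flag E M by fact
  interpret N: tropical_flag E N by fact
  define P where "P = {e \<in> E. e < p}"
  \<comment> \<open>For \<open>k < p < q\<close> the entry at \<open>insert p L\<close> stands
    outside the \<open>min\<close> and the one at \<open>insert k (insert p L)\<close> inside. Hence
    elements below \<open>p\<close> can be removed, starting from all of \<open>P\<close>.\<close>
  have down: "N (insert p (P - S)) = M (insert p (P - S))" if "finite S" "S \<subseteq> P" for S
    using that
  proof (induction S rule: finite_induct)
    case empty
    have "insert p P = {e \<in> E. e \<le> p}"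
      using pq by (auto simp: P_def)
    then show ?case
      using start by simp
  next
    case (insert k S)
    define L where "L = P - insert k S"
    have "P - S = insert k L" "k \<notin> L" "L \<subseteq> P" "k \<in> E" "k < p"
      using insert by (auto simp: L_def P_def)
    moreover have "L \<subseteq> E" "p \<notin> L" "q \<notin> L"
      using pq by (auto simp: L_def P_def)
    ultimately show ?case
      using insert pq M.pluecker[of k p q L] N.pluecker[of k p q L]
        same[of L] same[of "insert q L"]
        same[of "insert k L"] same[of "insert k (insert q L)"] same[of "insert p (insert q L)"]
      by (auto simp: L_def[symmetric] insert_commute)
  qed
  \<comment> \<open>For \<open>p < q < k\<close> it is the larger set that stands outside the
    \<open>min\<close>, so elements above \<open>q\<close> are added.\<close>
  have up: "N (insert p (A \<union> B)) = M (insert p (A \<union> B))" if "finite B" "B \<subseteq> {e \<in> E. q < e}" "A \<subseteq> P" for A B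
    using that
  proof (induction B rule: finite_induct)
    case empty
    have "P - (P - A) = A" "finite (P - A)"
      using empty \<open>finite E\<close> by (auto simp: P_def)
    then show ?case
      using down[of "P - A"] by auto
  next
    case (insert k B)
    define L where "L = A \<union> B"
    have "A \<union> insert k B = insert k L" "k \<notin> L" "k \<in> E" "q < k" "L \<subseteq> E" "p \<notin> L" "q \<notin> L"
      using insert pq by (auto simp: L_def P_def)
    then show ?case
      using insert pq M.pluecker[of p q k L] N.pluecker[of p q k L]
        same[of L] same[of "insert q L"]
        same[of "insert k L"] same[of "insert k (insert q L)"] same[of "insert p (insert q L)"]
      by (auto simp: L_def[symmetric] insert_commute)
  qed
  show ?thesis
  proof (cases "p \<in> K \<and> q \<notin> K")
    case True
    then have "K = insert p ({e \<in> K. e < p} \<union> {e \<in> K. q < e})"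
      using pq(3,4) \<open>K \<subseteq> E\<close> by force
    moreover have "finite {e \<in> K. q < e}"
      using \<open>K \<subseteq> E\<close> \<open>finite E\<close> finite_subset by fastforce
    ultimately show ?thesis
      using up[of "{e \<in> K. q < e}" "{e \<in> K. e < p}"] \<open>K \<subseteq> E\<close> by (auto simp: P_def)
  qed (use same \<open>K \<subseteq> E\<close> in simp)
qed

section \<open>Passage to \<open>w\<^sub>0\<close>-BZ data\<close>

lemma BZ_datum_iff:
  "BZ_datum n M \<longleftrightarrow> tropical_flag {1..n+1} M \<and> (\<forall>K. K \<notin> Mn_proper n \<longrightarrow> M K = 0) \<and>
     (\<forall>i\<in>{1..n}. M {n + 2 - i..n+1} = 0)"
proof (intro iffI conjI; (elim conjE)?)
  assume M: "BZ_datum n M"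
  note conjs = M[unfolded BZ_datum_def]
  note sup = conjs[THEN conjunct2, THEN conjunct2, THEN conjunct1]
    and plu = conjs[THEN conjunct2, THEN conjunct2, THEN conjunct2]
  show "\<forall>K. K \<notin> Mn_proper n \<longrightarrow> M K = 0" "\<forall>i\<in>{1..n}. M {n + 2 - i..n+1} = 0"
    by (fact conjs[THEN conjunct1] conjs[THEN conjunct2, THEN conjunct1])+
  show "tropical_flag {1..n+1} M"
  proof
    fix a b K
    assume "a \<in> {1..n+1}" "b \<in> {1..n+1}" "a \<noteq> b" "K \<subseteq> {1..n+1}" "a \<notin> K" "b \<notin> K"
    then show "M (insert a K) + M (insert b K) \<le> M (insert a (insert b K)) + M K"
      using sup[rule_format, of a b K] by (simp add: Mn_def)
  next
    fix a b c K
    assume "a \<in> {1..n+1}" "b \<in> {1..n+1}" "c \<in> {1..n+1}" "a < b" "b < c"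
      "K \<subseteq> {1..n+1}" "a \<notin> K" "b \<notin> K" "c \<notin> K"
    then show "M (insert a (insert c K)) + M (insert b K) =
        min (M (insert a (insert b K)) + M (insert c K)) (M (insert b (insert c K)) + M (insert a K))"
      using plu[rule_format, of a b c K] by (simp add: Mn_def)
  qed
next
  assume "tropical_flag {1..n+1} M"
    and M: "\<forall>K. K \<notin> Mn_proper n \<longrightarrow> M K = 0" "\<forall>i\<in>{1..n}. M {n + 2 - i..n+1} = 0"
  then interpret tropical_flag "{1..n+1}" M
    by simp
  show "BZ_datum n M"
    unfolding BZ_datum_def
  proof (intro conjI ballI impI M)
    fix a b K
    assume "a \<in> {1..n+1}" "b \<in> {1..n+1}" "K \<in> Mn n" "a \<noteq> b \<and> K \<inter> {a, b} = {}"
    then show "M (K \<union> {a}) + M (K \<union> {b}) \<le> M (K \<union> {a, b}) + M K"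
      using supermodular[of a b K] by (simp add: Mn_def)
  next
    fix a b c K
    assume "a \<in> {1..n+1}" "b \<in> {1..n+1}" "c \<in> {1..n+1}" "K \<in> Mn n"
      "a < b \<and> b < c \<and> K \<inter> {a, b, c} = {}"
    then show "M (K \<union> {a, c}) + M (K \<union> {b}) =
        min (M (K \<union> {a, b}) + M (K \<union> {c})) (M (K \<union> {b, c}) + M (K \<union> {a}))"
      using pluecker[of a b c K] by (simp add: Mn_def)
  qed (use M(2) in blast)
qed

theorem theorem5p5p1:
  fixes n i :: nat and M :: "nat set \<Rightarrow> int" and K :: "nat set"
  assumes "n \<ge> 1"
    and "BZ_datum n M"
    and "i \<in> {1..n}"
    and "K \<in> Mn_proper n"
  shows "lowering n i M K =
    (if i \<in> K \<and> i + 1 \<notin> K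
     then min (M K) (M (transpose i (i + 1) ` K) + BZ_c i M)
     else M K)"
proof -
  let ?E = "{1..n+1}"
  \<comment> \<open>The cutoff is for sets not contained in \<open>?E\<close>, where
    \<open>lower\<close> may be nonzero. At the empty and the full set \<open>lower\<close> already
    gives zero.\<close>
  define N where "N K = (if K \<in> Mn_proper n then lower i (i + 1) (BZ_c i M) M K else 0)" for K
  have M: "tropical_flag ?E M" "\<And>K. K \<notin> Mn_proper n \<Longrightarrow> M K = 0" "\<And>j. j \<in> {1..n} \<Longrightarrow> M {n + 2 - j..n+1} = 0"
    using assms(2) unfolding BZ_datum_iff by auto
  interpret M: tropical_flag ?E M
    by (fact M(1))
  have i: "i \<in> ?E" "i + 1 \<in> ?E"
    using assms(3) by auto
  have N_eq: "N K = lower i (i + 1) (BZ_c i M) M K" if "K \<subseteq> ?E" for K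
    using that i M(2)[of K] by (auto simp: N_def lower_def Mn_proper_def Mn_def)
  have N_same: "N K = M K" if "\<not> (i \<in> K \<and> i + 1 \<notin> K)" for K
    using that M(2)[of K] by (auto simp: N_def lower_def)
  interpret L: tropical_flag ?E "lower i (i + 1) (BZ_c i M) M"
    using i by (intro M.tropical_flag_lower) auto
  have "tropical_flag ?E N"
  proof
    fix a b K
    assume "a \<in> ?E" "b \<in> ?E" "a \<noteq> b" "K \<subseteq> ?E" "a \<notin> K" "b \<notin> K"
    then show "N (insert a K) + N (insert b K) \<le> N (insert a (insert b K)) + N K"
      using L.supermodular[of a b K] by (simp add: N_eq)
  next
    fix a b c K
    assume "a \<in> ?E" "b \<in> ?E" "c \<in> ?E" "a < b" "b < c" "K \<subseteq> ?E" "a \<notin> K" "b \<notin> K" "c \<notin> K"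
    then show "N (insert a (insert c K)) + N (insert b K) =
        min (N (insert a (insert b K)) + N (insert c K)) (N (insert b (insert c K)) + N (insert a K))"
      using L.pluecker[of a b c K] by (simp add: N_eq)
  qed
  \<comment> \<open>A final segment containing \<open>i\<close> also contains \<open>i + 1\<close>,
    so its entry is unchanged.\<close>
  moreover have "N {n + 2 - j..n+1} = 0" if "j \<in> {1..n}" for j
    using M(3)[OF that] assms(3) by (subst N_same) auto
  ultimately have N_datum: "BZ_datum n N"
    unfolding BZ_datum_iff by (simp add: N_def)
  \<comment> \<open>The constant \<open>BZ_c i M\<close> is chosen so that the second argument of
    the \<open>min\<close> at \<open>{1..i}\<close> equals \<open>M {1..i} - 1\<close>.\<close>
  have N_start: "N {1..i} = M {1..i} - 1"
  proof -
    have "insert (i + 1) ({1..i} - {i}) = {1..i + 1} - {i}"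
      using assms(3) by auto
    then show ?thesis
      using assms(3) by (simp add: N_eq lower_def BZ_c_def)
  qed
  have N_unique: "N' = N"
    if N': "BZ_datum n N'" "N' {1..i} = M {1..i} - 1"
      "\<forall>K\<in>Mn_proper n. \<not> (i \<in> K \<and> i + 1 \<notin> K) \<longrightarrow> N' K = M K" for N'
  proof
    fix K
    have eq: "{e \<in> ?E. e \<le> i} = {1..i}"
      using assms(3) by auto
    show "N' K = N K"
    proof (cases "K \<subseteq> ?E")
      case True
      show ?thesis
      proof (rule tropical_flag_unique[where E = ?E and p = i and q = "i + 1"])
        show "tropical_flag ?E N'"
          using N'(1) unfolding BZ_datum_iff by blast
        show "N' K = N K" if "\<not> (i \<in> K \<and> i + 1 \<notin> K)" for K
          using that N' M(2)[of K] N_same[of K] unfolding BZ_datum_iff by (cases "K \<in> Mn_proper n") auto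
        show "N' {e \<in> ?E. e \<le> i} = N {e \<in> ?E. e \<le> i}"
          using N'(2) N_start unfolding eq by simp
      qed (use True i \<open>tropical_flag ?E N\<close> in auto)
    next
      case False
      then show ?thesis
        using N'(1) unfolding BZ_datum_iff N_def by (simp add: Mn_proper_def Mn_def)
    qed
  qed
  have "lowering n i M = N"
    unfolding lowering_def
  proof (rule the_equality)
    show "BZ_datum n N \<and> N {1..i} = M {1..i} - 1 \<and>
        (\<forall>K\<in>Mn_proper n. \<not> (i \<in> K \<and> i + 1 \<notin> K) \<longrightarrow> N K = M K)"
      by (intro conjI ballI impI N_datum N_start N_same)
  qed (elim conjE, rule N_unique)
  moreover have "insert (i + 1) (K - {i}) = transpose i (i + 1) ` K" if "i \<in> K" "i + 1 \<notin> K"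
    using that by (auto simp: transpose_def image_iff)
  ultimately show ?thesis
    using assms(4) by (auto simp: N_def lower_def)
qed

end
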